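(* Let $a\geq 3$ be an integer and let $R_2(m,a)$ denote the 2-color Rado number of $x_1+\cdots+x_{m-1}=ax_m$, and $C(m,a)=\left\lceil\frac{m-1}{a}\left\lceil\frac{m-1}{a}\right\rceil\right\rceil$. If $3\mid a$, then $R_2(m,a)=C(m,a)$ for all integers $m\geq 2a+1$, but $R_2(2a,a)=5$ and $C(2a,a)=4$. If $3\nmid a$, then $R_2(m,a)=C(m,a)$ for all integers $m\geq 2a+2$, but $R_2(2a+1,a)=5$ and $C(2a+1,a)=4$.
   Context: The 2-color Rado number $R_2(m,a)$ of $x_1+\cdots+x_{m-1}=ax_m$ is the least positive integer $n$ such that for every coloring of $[n]=\{1,\dots,n\}$ with two colors there exist $x_1,\dots,x_m\in[n]$ (not necessarily distinct), all of the same color, satisfying the equation. *)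

theory Defs
  imports Complex_Main "HOL-Library.Extended_Nat"
begin

definition mono_solution :: "nat \<Rightarrow> nat \<Rightarrow> nat \<Rightarrow> (nat \<Rightarrow> bool) \<Rightarrow> (nat \<Rightarrow> nat) \<Rightarrow> bool" where
  "mono_solution m a n c x \<longleftrightarrow>
     (\<forall>i\<in>{1..m}. x i \<in> {1..n}) \<and>
     (\<forall>i\<in>{1..m}. \<forall>j\<in>{1..m}. c (x i) = c (x j)) \<and>
     (\<Sum>i = 1..m - 1. x i) = a * x m"

(* Colorings are functions on all of nat, but only their values on {1..n} matter.
   The least n is taken in enat, so that the value is infinite if no such n exists. *)
definition rado2 :: "nat \<Rightarrow> nat \<Rightarrow> enat" where
  "rado2 m a = Inf {enat n | n. 1 \<le> n \<and> (\<forall>c :: nat \<Rightarrow> bool. \<exists>x. mono_solution m a n c x)}"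

definition C_bound :: "nat \<Rightarrow> nat \<Rightarrow> nat" where
  "C_bound m a =
     nat \<lceil>(real m - 1) / real a * real_of_int \<lceil>(real m - 1) / real a\<rceil>\<rceil>"

end

theory Submission
  imports Defs
begin

text \<open>Put \<open>k = m - 1\<close>, \<open>q = \<lceil>k / a\<rceil>\<close> and \<open>n = \<lceil>k q / a\<rceil>\<close>. Colouring \<open>{1..<q}\<close> red and
  \<open>{q..<n}\<close> blue avoids monochromatic solutions. Conversely, let \<open>k \<ge> 2 a + 1\<close> and suppose that a
  colouring of \<open>{1..n}\<close> with 1 red has no monochromatic solution. Two nearby numbers of one colour
  produce all sums in a long interval, which forces a long interval of the other colour, and the
  latter together with one small number of that colour solves the equation. If 2 is red, apply
  this to the longest red initial segment; otherwise to 1, 3, 4 (if 3 and 4 are red) or to 2, 3 (if 3 is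
  blue). In the remaining case 1, 3 are red and 2, 4 blue, and neither colour is possible for
  \<open>2 q\<close>.\<close>

section \<open>Sums of \<open>k\<close> elements of a set, repetitions allowed\<close>

definition ksum :: "nat set \<Rightarrow> nat \<Rightarrow> nat \<Rightarrow> bool" where
  "ksum S k s \<longleftrightarrow> (\<exists>xs. length xs = k \<and> set xs \<subseteq> S \<and> sum_list xs = s)"

lemma ksum_add: "ksum S j s \<Longrightarrow> ksum S l t \<Longrightarrow> ksum S (j + l) (s + t)"
  unfolding ksum_def
proof (elim exE conjE)
  fix xs ys
  assume "length xs = j" "set xs \<subseteq> S" "sum_list xs = s"
    "length ys = l" "set ys \<subseteq> S" "sum_list ys = t"
  then show "\<exists>zs. length zs = j + l \<and> set zs \<subseteq> S \<and> sum_list zs = s + t"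
    by (intro exI[of _ "xs @ ys"]) auto
qed

lemma ksum_replicate: "x \<in> S \<Longrightarrow> ksum S k (k * x)"
  unfolding ksum_def by (intro exI[of _ "replicate k x"]) (auto simp: sum_list_replicate)

lemma ksum_single: "x \<in> S \<Longrightarrow> ksum S 1 x"
  using ksum_replicate[of x S 1] by simp

lemma ksum_two:
  assumes "u \<in> S" "v \<in> S" "i + j = k" "s = i * u + j * v"
  shows "ksum S k s"
  using ksum_add[OF ksum_replicate[OF assms(1), of i] ksum_replicate[OF assms(2), of j]] assms(3,4)
  by simp

lemma ksum_ge:
  assumes "ksum S k s" "\<And>x. x \<in> S \<Longrightarrow> b \<le> x"
  shows "k * b \<le> s"
proof -
  obtain xs where xs: "length xs = k" "set xs \<subseteq> S" "sum_list xs = s"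
    using assms(1) unfolding ksum_def by blast
  have "length xs * b \<le> sum_list xs" using xs(2)
    by (induction xs) (use assms(2) in \<open>auto intro: add_mono\<close>)
  then show ?thesis using xs by simp
qed

text \<open>Greedy choice: the first summand is the largest one that leaves at least
  \<open>k * u\<close> for the others.\<close>

lemma ksum_interval:
  assumes "{u..v} \<subseteq> S" "k * u \<le> s" "s \<le> k * v"
  shows "ksum S k s"
  using assms(2,3)
proof (induction k arbitrary: s)
  case 0
  then show ?case by (simp add: ksum_def)
next
  case (Suc k)
  have uv: "u \<le> v" using Suc.prems by (metis Suc_mult_le_cancel1 le_trans)
  define x where "x = (if s - k * u \<le> v then s - k * u else v)"
  have kuv: "k * u \<le> k * v" using uv by simp
  have x: "u \<le> x" "x \<le> v" "k * u \<le> s - x" "s - x \<le> k * v" "x \<le> s"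
    using Suc.prems uv kuv by (auto simp: x_def)
  have "ksum S (1 + k) (x + (s - x))"
    using x assms(1) by (intro ksum_add ksum_single Suc.IH) auto
  then show ?case using x by simp
qed

text \<open>Replacing a 1 by 3 or 4 in a sum of \<open>k\<close> ones adds 2 or 3, so only the
  excess 1 is out of reach.\<close>

lemma ksum_one_three_four:
  assumes "1 \<in> S" "3 \<in> S" "4 \<in> S" "k \<le> s" "s \<le> 4 * k" "s \<noteq> k + 1"
  shows "ksum S k s"
  using assms(4-6)
proof (induction k arbitrary: s)
  case 0
  then show ?case by (simp add: ksum_def)
next
  case (Suc k)
  \<comment> \<open>A 4 is split off as soon as \<open>s\<close> allows it, except for
    \<open>s = k + 5\<close>, where it would leave the forbidden sum \<open>k + 1\<close>.\<close>
  define x where "x = (if s = k + 1 then 1 else if s = k + 3 \<or> s = k + 5 then 3 else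
     if s < k + 4 then 1 else (4::nat))"
  have "ksum S (1 + k) (x + (s - x))"
  proof (intro ksum_add ksum_single Suc.IH)
    show "x \<in> S" using assms(1-3) by (auto simp: x_def)
  qed (use Suc.prems in \<open>auto simp: x_def split: if_splits\<close>)
  moreover have "x \<le> s" using Suc.prems by (auto simp: x_def)
  ultimately show ?case by simp
qed

text \<open>From \<open>j = h\<close> on, the intervals \<open>{j * p..j * M}\<close> leave no gaps.\<close>
lemma ksum_gap:
  assumes S: "w \<in> S" "{w + p..w + M} \<subseteq> S" and h: "h \<le> k" "Suc h * p \<le> h * M + 1" "h * p \<le> d"
    and "p \<le> M" "d \<le> k * M"
  shows "ksum S k (k * w + d)"
proof -
  let ?P = "\<lambda>j. h \<le> j \<and> d \<le> j * M"
  \<comment> \<open>\<open>j\<close> counts the summands larger than \<open>w\<close>: as few as can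
    reach the excess \<open>d\<close>, but at least \<open>h\<close>.\<close>
  define j where "j = (LEAST j. ?P j)"
  have P: "?P k" using assms by simp
  have j: "?P j" unfolding j_def using P by (rule LeastI)
  have jk: "j \<le> k" unfolding j_def using P by (rule Least_le)
  have "j * p \<le> d"
  proof (cases "j = h")
    case True
    then show ?thesis using assms by simp
  next
    case False
    then obtain i where i: "j = Suc (h + i)"
      using j by (metis le_eq_less_or_eq less_iff_Suc_add)
    have "\<not> d \<le> (h + i) * M"
      using not_less_Least[of "h + i" ?P] i j_def by auto
    moreover have "i * p \<le> i * M" using assms(6) by simp
    ultimately have "Suc h * p + i * p \<le> d" using h(2) by (simp only: add_mult_distrib)
    then show ?thesis unfolding i by (simp add: algebra_simps)
  qed
  then have "ksum S j (j * w + d)" using j S(2)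
    by (intro ksum_interval[of "w + p" "w + M"]) (auto simp: algebra_simps)
  moreover have "ksum S (k - j) ((k - j) * w)" using S(1) by (rule ksum_replicate)
  ultimately have "ksum S (j + (k - j)) (j * w + d + (k - j) * w)" by (rule ksum_add)
  moreover have "j * w + d + (k - j) * w = k * w + d"
    using jk by (metis add.commute add.left_commute add_mult_distrib le_add_diff_inverse)
  ultimately show ?thesis using jk by simp
qed

section \<open>Numbers excluded from a solution-free set\<close>

definition solution_free :: "nat \<Rightarrow> nat \<Rightarrow> nat set \<Rightarrow> bool" where
  "solution_free a k S \<longleftrightarrow> (\<forall>x\<in>S. \<not> ksum S k (a * x))"

lemma solution_freeD: "solution_free a k S \<Longrightarrow> x \<in> S \<Longrightarrow> ksum S k (a * x) \<Longrightarrow> False"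
  unfolding solution_free_def by blast

text \<open>Cancelling \<open>a - i\<close> copies of \<open>x\<close> on both sides of the equation.\<close>
lemma solution_free_notin:
  assumes "solution_free a k S" "i \<le> a" "a \<le> k" "ksum S (k - a + i) (i * x)"
  shows "x \<notin> S"
proof
  assume "x \<in> S"
  then have "ksum S (k - a + i + (a - i)) (i * x + (a - i) * x)"
    using assms by (intro ksum_add ksum_replicate) auto
  moreover have "i * x + (a - i) * x = a * x" using assms(2)
    by (metis add_mult_distrib le_add_diff_inverse)
  ultimately show False using assms \<open>x \<in> S\<close> solution_freeD by fastforce
qed

text \<open>Selects how many copies of \<open>x\<close> stay on the right after cancellation: the
  first multiple of \<open>z\<close> to reach \<open>d\<close>, so that the previous one bounds the
  overshoot.\<close>

lemma ex_crossing_multiple: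
  fixes a d z :: nat
  assumes "d \<le> a * z" "1 \<le> a"
  obtains i where "1 \<le> i" "i \<le> a" "d \<le> i * z" "i = 1 \<or> (i - 1) * z < d"
proof -
  let ?P = "\<lambda>i. 1 \<le> i \<and> d \<le> i * z"
  define i where "i = (LEAST i. ?P i)"
  have P: "?P a" using assms by simp
  have "?P i" unfolding i_def using P by (rule LeastI)
  moreover have "i \<le> a" unfolding i_def using P by (rule Least_le)
  moreover have "\<not> ?P (i - 1)"
    using not_less_Least[of "i - 1" ?P] \<open>?P i\<close> unfolding i_def by fastforce
  ultimately show thesis using that by (metis One_nat_def Suc_leI le_neq_implies_less less_nat_zero_code linorder_not_less
      zero_less_diff)
qed

text \<open>With \<open>x = u + z\<close> and \<open>e = k - a\<close>, some \<open>i\<close> must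
  satisfy \<open>u * (e + i) \<le> i * x \<le> v * (e + i)\<close>. The least \<open>i\<close>
  meeting the lower bound works: if \<open>i \<ge> 2\<close>, then
  \<open>i * z \<le> 2 * (i - 1) * z < 2 * u * e \<le> v * e\<close>; if \<open>i = 1\<close>, the
  upper bound is the assumption on \<open>x\<close>.\<close>

lemma solution_free_interval_double:
  assumes sf: "solution_free a k S" and S: "{u..v} \<subseteq> S" and "2 * u \<le> v" "1 \<le> a" "a \<le> k"
    and x: "u * k \<le> a * x" "x \<le> v * (k - a + 1)"
  shows "x \<notin> S"
proof -
  obtain e where k: "k = a + e" using assms(5) le_Suc_ex by blast
  have "a * u + u * e \<le> a * x" using x(1) unfolding k by (simp add: algebra_simps)
  then have "a * u \<le> a * x" by (rule add_leD1)
  then have "u \<le> x" using assms(4) by simp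
  then obtain z where z: "x = u + z" using le_Suc_ex by blast
  have "u * e \<le> a * z" using x(1) unfolding k z by (simp add: algebra_simps)
  then obtain i where i: "1 \<le> i" "i \<le> a" "u * e \<le> i * z" "i = 1 \<or> (i - 1) * z < u * e"
    using ex_crossing_multiple assms(4) by metis
  have "i * x \<le> v * (e + i)"
  proof (cases "i = 1")
    case True
    then show ?thesis using x(2) by (simp add: k)
  next
    case False
    then obtain j where j: "i = j + 2" using i(1)
      by (metis One_nat_def Suc_1 add.commute add_2_eq_Suc' nat.exhaust not_one_le_zero)
    then have "(j + 1) * z < u * e" using i(4) by simp
    then have "(j + 2) * z \<le> 2 * u * e" by (simp add: algebra_simps)
    also have "\<dots> \<le> v * e" using assms(3) by simp
    finally have "i * z \<le> v * e" using j by simp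
    moreover have "i * u \<le> i * v" using assms(3) by simp
    ultimately have "i * u + i * z \<le> i * v + v * e" by (rule add_mono[rotated])
    then show ?thesis unfolding z by (simp add: algebra_simps)
  qed
  then have "ksum S (k - a + i) (i * x)" using i(3) S
    by (intro ksum_interval[of u v]) (auto simp: k z algebra_simps)
  then show ?thesis using sf i(2) assms(5) solution_free_notin by blast
qed

text \<open>As for intervals with \<open>2 * u \<le> v\<close>, but the ratio is only 3/2, and
  \<open>i \<le> 3 / 2 * (i - 1)\<close> requires \<open>i \<ge> 3\<close>. The case
  \<open>i = 2\<close> is the assumed upper bound on \<open>x\<close>, and \<open>i = 1\<close> is
  impossible because \<open>k - a \<ge> 3\<close>.\<close>

lemma solution_free_two_three:
  assumes sf: "solution_free a k S" and S: "2 \<in> S" "3 \<in> S" and a: "1 \<le> a" "a + 3 \<le> k"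
    and x: "2 * k \<le> a * x" "2 * x \<le> 3 * (k - a) + 6"
  shows "x \<notin> S"
proof -
  obtain e where k: "k = a + e" using a(2) le_Suc_ex add_leE by blast
  have "a * 2 + 2 * e \<le> a * x" using x(1) unfolding k by (simp add: algebra_simps)
  then have "a * 2 \<le> a * x" by (rule add_leD1)
  then have "2 \<le> x" using a(1) by simp
  then obtain z where z: "x = 2 + z" using le_Suc_ex by blast
  have "2 * e \<le> a * z" using x(1) unfolding k z by (simp add: algebra_simps)
  then obtain i where i: "1 \<le> i" "i \<le> a" "2 * e \<le> i * z" "i = 1 \<or> (i - 1) * z < 2 * e"
    using ex_crossing_multiple a(1) by metis
  have "i \<noteq> 1" using i(3) x(2) a(2) unfolding z k by auto
  have "i * x \<le> 3 * (e + i)"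
  proof (cases "i = 2")
    case True
    then show ?thesis using x(2) by (simp add: k)
  next
    case False
    obtain j where j: "i = j + 3" using i(1) False \<open>i \<noteq> 1\<close>
      by (metis Suc_1 add.commute le_Suc_ex le_antisym not_less_eq_eq numeral_3_eq_3 One_nat_def)
    then have "(j + 2) * z < 2 * e" using i(4) by simp
    then have "(j + 3) * z \<le> 3 * e" by (simp add: algebra_simps)
    then show ?thesis unfolding z j by (simp add: algebra_simps)
  qed
  moreover have "{2..3} \<subseteq> S"
  proof
    fix y :: nat assume "y \<in> {2..3}"
    then have "y = 2 \<or> y = 3" by auto
    then show "y \<in> S" using S by auto
  qed
  ultimately have "ksum S (k - a + i) (i * x)" using i(3)
    by (intro ksum_interval[of 2 3]) (auto simp: k z algebra_simps)
  then show ?thesis using sf i(2) a solution_free_notin by simp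
qed

text \<open>The same argument with 1 and 4 as extremes. Crossing \<open>e + 2\<close> instead of
  \<open>e\<close> makes the sum exceed the number of summands by at least 2, which avoids the one
  unreachable value.\<close>

lemma solution_free_one_three_four:
  assumes sf: "solution_free a k S" and S: "1 \<in> S" "3 \<in> S" "4 \<in> S" and a: "1 \<le> a" "a + 1 \<le> k"
    and x: "k + 2 \<le> a * x" "x \<le> 4 * (k - a + 1)"
  shows "x \<notin> S"
proof -
  obtain e where k: "k = a + e" using a(2) le_Suc_ex add_leE by blast
  have "x \<noteq> 0" using x(1) by (intro notI) simp
  then obtain z where z: "x = 1 + z" using not0_implies_Suc by auto
  have "e + 2 \<le> a * z" using x(1) unfolding k z by (simp add: algebra_simps)
  then obtain i where i: "1 \<le> i" "i \<le> a" "e + 2 \<le> i * z" "i = 1 \<or> (i - 1) * z < e + 2"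
    using ex_crossing_multiple a(1) by metis
  have "i * x \<le> 4 * (e + i)"
  proof (cases "i = 1")
    case True
    then show ?thesis using x(2) by (simp add: k)
  next
    case False
    then obtain j where j: "i = j + 2" using i(1)
      by (metis One_nat_def Suc_1 add.commute add_2_eq_Suc' nat.exhaust not_one_le_zero)
    then have "(j + 1) * z < e + 2" using i(4) by simp
    moreover have "1 \<le> e" using a(2) k by simp
    ultimately have "(j + 2) * z \<le> 4 * e" by (simp add: algebra_simps)
    then show ?thesis unfolding z j by (simp add: algebra_simps)
  qed
  then have "ksum S (k - a + i) (i * x)" using i(3) S
    by (intro ksum_one_three_four) (auto simp: k z algebra_simps)
  then show ?thesis using sf i(2) a solution_free_notin by simp
qed

section \<open>From colourings to solution-free sets\<close>

lemma mono_solution_iff_ksum: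
  "(\<exists>x. mono_solution (Suc k) a n c x) \<longleftrightarrow>
     (\<exists>y\<in>{1..n}. ksum {z \<in> {1..n}. c z = c y} k (a * y))"
proof
  assume "\<exists>x. mono_solution (Suc k) a n c x"
  then obtain x where "mono_solution (Suc k) a n c x" by blast
  then have x: "\<And>i. i \<in> {1..Suc k} \<Longrightarrow> x i \<in> {1..n}"
    "\<And>i j. i \<in> {1..Suc k} \<Longrightarrow> j \<in> {1..Suc k} \<Longrightarrow> c (x i) = c (x j)"
    "(\<Sum>i = 1..k. x i) = a * x (Suc k)"
    unfolding mono_solution_def diff_Suc_1 by blast+
  let ?S = "{z \<in> {1..n}. c z = c (x (Suc k))}"
  have "set (map x [1..<Suc k]) \<subseteq> ?S"
  proof
    fix z assume "z \<in> set (map x [1..<Suc k])"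
    then obtain i where i: "i \<in> {1..<Suc k}" "z = x i"
      unfolding set_map set_upt by blast
    then show "z \<in> ?S" using x(1)[of i] x(2)[of i "Suc k"] by simp
  qed
  moreover have "sum_list (map x [1..<Suc k]) = a * x (Suc k)"
    using x(3) by (simp only: interv_sum_list_conv_sum_set_nat set_upt atLeastLessThanSuc_atLeastAtMost)
  ultimately have "ksum ?S k (a * x (Suc k))"
    unfolding ksum_def by (intro exI[of _ "map x [1..<Suc k]"]) simp
  then show "\<exists>y\<in>{1..n}. ksum {z \<in> {1..n}. c z = c y} k (a * y)"
    using x(1)[of "Suc k"] by auto
next
  assume "\<exists>y\<in>{1..n}. ksum {z \<in> {1..n}. c z = c y} k (a * y)"
  then obtain y xs where y: "y \<in> {1..n}" and xs: "length xs = k"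
    "set xs \<subseteq> {z \<in> {1..n}. c z = c y}" "sum_list xs = a * y"
    unfolding ksum_def by blast
  \<comment> \<open>The list is indexed from 0 and the variables from 1; \<open>y\<close> becomes
    the last variable.\<close>
  let ?x = "\<lambda>i. if i = Suc k then y else xs ! (i - 1)"
  have in_class: "?x i \<in> {1..n} \<and> c (?x i) = c y" if "i \<in> {1..Suc k}" for i
  proof (cases "i = Suc k")
    case False
    then have "xs ! (i - 1) \<in> set xs" using that xs(1) by (intro nth_mem) auto
    then show ?thesis using xs(2) False by auto
  qed (use y in auto)
  have "(\<Sum>i = 1..k. ?x i) = (\<Sum>i = 1..k. xs ! (i - 1))" by (rule sum.cong) auto
  also have "\<dots> = (\<Sum>i<k. xs ! i)"
    by (rule sum.reindex_bij_witness[of _ Suc "\<lambda>i. i - 1"]) auto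
  also have "\<dots> = a * y" using xs(1,3) by (simp add: sum_list_sum_nth lessThan_atLeast0)
  finally have "(\<Sum>i = 1..k. ?x i) = a * y" .
  then have "mono_solution (Suc k) a n c ?x"
    using in_class unfolding mono_solution_def by simp
  then show "\<exists>x. mono_solution (Suc k) a n c x" by blast
qed

lemma no_mono_solution_iff:
  "(\<nexists>x. mono_solution (Suc k) a n c x) \<longleftrightarrow>
     solution_free a k {z \<in> {1..n}. c z} \<and> solution_free a k {z \<in> {1..n}. \<not> c z}"
proof -
  have "{z \<in> {1..n}. c z = c y} = (if c y then {z \<in> {1..n}. c z} else {z \<in> {1..n}. \<not> c z})" for y
    by auto
  then show ?thesis unfolding mono_solution_iff_ksum solution_free_def by auto
qed

lemma mono_solution_mono: "mono_solution m a n c x \<Longrightarrow> n \<le> n' \<Longrightarrow> mono_solution m a n' c x"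
  unfolding mono_solution_def by fastforce

text \<open>The colouring \<open>c\<close> also rules out all values below \<open>N\<close>, since a
  solution in a shorter range remains one in a longer range. Exchanging the colours allows
  \<open>upper\<close> to assume that 1 is in \<open>R\<close>.\<close>

lemma rado2_eqI:
  assumes N: "1 \<le> N"
    and lower: "solution_free a k {z \<in> {1..N - 1}. c z}" "solution_free a k {z \<in> {1..N - 1}. \<not> c z}"
    and upper: "\<And>R B. \<lbrakk>R \<union> B = {1..N}; 1 \<in> R; solution_free a k R; solution_free a k B\<rbrakk> \<Longrightarrow> False"
  shows "rado2 (Suc k) a = enat N"
proof (rule antisym)
  have "\<exists>x. mono_solution (Suc k) a N c x" for c
  proof (rule ccontr)
    assume "\<nexists>x. mono_solution (Suc k) a N c x"
    then have *: "solution_free a k {z \<in> {1..N}. c z}" "solution_free a k {z \<in> {1..N}. \<not> c z}"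
      using no_mono_solution_iff by blast+
    show False
    proof (cases "c 1")
      case True
      then show False using N by (intro upper[OF _ _ *]) auto
    next
      case False
      then show False using N by (intro upper[OF _ _ *(2,1)]) auto
    qed
  qed
  then show "rado2 (Suc k) a \<le> enat N"
    unfolding rado2_def using N by (intro Inf_lower) auto
  show "enat N \<le> rado2 (Suc k) a"
    unfolding rado2_def
  proof (rule Inf_greatest)
    fix e assume "e \<in> {enat n | n. 1 \<le> n \<and> (\<forall>c. \<exists>x. mono_solution (Suc k) a n c x)}"
    then obtain n where n: "e = enat n" "\<exists>x. mono_solution (Suc k) a n c x" by blast
    have "\<not> n \<le> N - 1"
      using n(2) mono_solution_mono no_mono_solution_iff[of k a "N - 1" c] lower by blast
    then show "enat N \<le> e" using n(1) by simp
  qed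
qed

section \<open>Residues of sums, and integer bounds for the ceilings\<close>

text \<open>Serves to show that the class \<open>{1, 4}\<close>, constant modulo 3, contains no
  solution in the short cases.\<close>

lemma ksum_cong_mod:
  assumes "ksum S k s" "\<And>x. x \<in> S \<Longrightarrow> x mod m = r mod m"
  shows "s mod m = (k * r) mod m"
proof -
  obtain xs where xs: "length xs = k" "set xs \<subseteq> S" "sum_list xs = s"
    using assms(1) unfolding ksum_def by blast
  have "sum_list xs mod m = (length xs * r) mod m" using xs(2)
  proof (induction xs)
    case (Cons x xs)
    then show ?case using assms(2)[of x] by (metis (no_types, lifting) insert_subset length_Cons
          list.simps(15) mod_add_cong mult_Suc sum_list.Cons)
  qed simp
  then show ?thesis using xs by simp
qed

lemma nat_ceiling_div_bounds:
  fixes x a :: nat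
  assumes "a > 0"
  defines "y \<equiv> nat \<lceil>real x / real a\<rceil>"
  shows "x \<le> a * y" "a * y < x + a"
proof -
  have "0 \<le> real x / real a" by simp
  then have "real x / real a \<le> real y" "real y < real x / real a + 1"
    unfolding y_def by linarith+
  then have "real x \<le> real (a * y)" "real (a * y) < real (x + a)"
    using assms(1) by (simp_all add: field_simps)
  then show "x \<le> a * y" "a * y < x + a"
    by (simp_all only: of_nat_le_iff of_nat_less_iff)
qed

text \<open>Here \<open>q\<close> is the inner ceiling. The four inequalities characterise both
  ceilings over the natural numbers, so that the reals disappear from the later arguments.\<close>

lemma C_bound_bounds:
  fixes a k :: nat
  assumes "a > 0"
  obtains q where "k \<le> a * q" "a * q < k + a"
    "k * q \<le> a * C_bound (Suc k) a" "a * C_bound (Suc k) a < k * q + a"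
proof -
  define q where "q = nat \<lceil>real k / real a\<rceil>"
  have "real_of_int \<lceil>real k / real a\<rceil> = real q"
    unfolding q_def by (simp add: le_of_int_ceiling order.trans[OF _ le_of_int_ceiling])
  then have "C_bound (Suc k) a = nat \<lceil>real (k * q) / real a\<rceil>"
    unfolding C_bound_def by simp
  then show thesis
    using that[of q] nat_ceiling_div_bounds[OF assms, of k] nat_ceiling_div_bounds[OF assms, of "k * q"]
    unfolding q_def by simp
qed

lemma C_bound_eq_4:
  fixes a k :: nat
  assumes "a \<ge> 3" "k \<le> 2 * a" "2 * a \<le> k + 1"
  shows "C_bound (Suc k) a = 4"
proof -
  obtain q where q: "k \<le> a * q" "a * q < k + a"
    "k * q \<le> a * C_bound (Suc k) a" "a * C_bound (Suc k) a < k * q + a"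
    using C_bound_bounds[of a k] assms(1) by auto
  have "a * 1 < a * q" "a * q < a * 3" using q assms by linarith+
  then have "q = 2" unfolding mult_less_cancel1 by linarith
  then have "a * 3 < a * C_bound (Suc k) a" "a * C_bound (Suc k) a < a * 5"
    using q(3,4) assms unfolding \<open>q = 2\<close> by linarith+
  then show ?thesis unfolding mult_less_cancel1 by linarith
qed

section \<open>Upper bound for \<open>k \<ge> 2 * a + 1\<close>\<close>

text \<open>Describes a hypothetical colouring of \<open>{1..n}\<close> without monochromatic
  solution, \<open>n\<close> being the value of \<open>C_bound\<close>; the aim is a
  contradiction.\<close>

locale long_rado_coloring =
  fixes a k q n :: nat and R B :: "nat set"
  assumes a: "3 \<le> a" and k: "2 * a + 1 \<le> k"
    and q: "k \<le> a * q" "a * q < k + a"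
    and n: "k * q \<le> a * n" "a * n < k * q + a"
    and RB: "R \<union> B = {1..n}" "1 \<in> R"
    and R: "solution_free a k R" and B: "solution_free a k B"
begin

lemma q_ge_3: "3 \<le> q"
proof -
  have "a * 2 < a * q" using q k by linarith
  then show ?thesis by simp
qed

lemma two_q_le_n: "2 * q \<le> n"
proof -
  have "a * (2 * q) = 2 * a * q" by simp
  also have "\<dots> \<le> k * q" using k by (intro mult_le_mono1) simp
  also have "\<dots> \<le> a * n" by (rule n(1))
  finally show ?thesis using a by simp
qed

lemma n_ge_7: "7 \<le> n"
proof -
  have "a * 6 < (2 * a + 1) * 3" by simp
  also have "\<dots> \<le> k * q" using k q_ge_3 by (intro mult_le_mono)
  also have "\<dots> \<le> a * n" by (rule n(1))
  finally show ?thesis by simp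
qed

lemma mem_union: "1 \<le> x \<Longrightarrow> x \<le> n \<Longrightarrow> x \<in> R \<or> x \<in> B"
  using RB(1) by (metis UnE atLeastAtMost_iff)

lemma three_q_bound: "3 * q < k + a"
proof -
  have "3 * q \<le> a * q" using a by simp
  then show ?thesis using q(2) by linarith
qed

lemma two_notin_R: "2 \<notin> R"
proof
  assume "2 \<in> R"
  let ?P = "\<lambda>s. s \<noteq> 0 \<and> s \<notin> R"
  define s where "s = (LEAST s. ?P s)"
  have "n + 1 \<notin> R \<union> B" unfolding RB(1) by simp
  then have "?P (n + 1)" by simp
  then have s: "?P s" unfolding s_def by (rule LeastI)
  have least: "x \<in> R" if "x \<noteq> 0" "x < s" for x
    using not_less_Least[of x ?P] that unfolding s_def by blast
  have "s \<noteq> 1" "s \<noteq> 2" using RB(2) \<open>2 \<in> R\<close> s by auto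
  then obtain t where t: "s = t + 1" "2 \<le> t" using s that[of "s - 1"] by fastforce
  \<comment> \<open>The initial segment \<open>{1..t}\<close> is red, and \<open>T\<close> is the
    largest number to which \<open>solution_free_interval_double\<close> with \<open>u = 1\<close>
    and \<open>v = t\<close> applies.\<close>
  define T where "T = t * (k - a + 1)"
  have T: "2 * (k - a + 1) \<le> T" unfolding T_def using t(2) by (rule mult_le_mono1)
  have blue: "x \<in> B" if "q \<le> x" "x \<le> T" "x \<le> n" for x
  proof -
    have "k \<le> a * x" using q(1) that(1) by (meson le_trans mult_le_mono2)
    then have "x \<notin> R" using t a k that(2)
      by (intro solution_free_interval_double[OF R, of 1 t]) (auto intro: least simp: T_def)
    then show ?thesis using mem_union[of x] that q_ge_3 by simp
  qed
  have "q \<in> B" "q + 1 \<in> B"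
    using T three_q_bound two_q_le_n q_ge_3 k by (auto intro!: blue)
  moreover have "{q..q + 1} = {q, q + 1}" by auto
  \<comment> \<open>The bounds on \<open>n\<close> give
    \<open>k * q \<le> a * n < k * q + a \<le> k * (q + 1)\<close>.\<close>
  ultimately have "ksum B k (a * n)"
    using n k by (intro ksum_interval[of q "q + 1"]) auto
  then have "n \<notin> B" using B solution_freeD by blast
  then have "T < n" using blue[of n] two_q_le_n by linarith
  have "t \<le> T" unfolding T_def by simp
  then have "s \<in> B" using s mem_union[of s] t \<open>T < n\<close> by simp
  \<comment> \<open>The blue solution: \<open>k - 1\<close> copies of \<open>s\<close> and one \<open>y\<close> in \<open>{q..<q + a}\<close> making the sum divisible by \<open>a\<close>.\<close>
  define x where "x = ((k - 1) * s + q + a - 1) div a"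
  define y where "y = a * x - (k - 1) * s"
  have "a * x \<le> (k - 1) * s + q + a - 1" unfolding x_def by simp
  moreover have "(k - 1) * s + q + a - 1 < a * x + a"
    unfolding x_def using a dividend_less_times_div[of a] by (simp add: add.commute)
  ultimately have ax: "(k - 1) * s + q \<le> a * x" "a * x + 1 \<le> (k - 1) * s + q + a" using a by linarith+
  have y: "q \<le> y" "y + 1 \<le> q + a" "(k - 1) * s + y = a * x" using ax unfolding y_def by linarith+
  have "(k - 1) * 3 \<le> (k - 1) * s" using t by simp
  then have "a * q \<le> a * x" using ax q k by linarith
  then have "q \<le> x" using a by simp
  \<comment> \<open>Writing \<open>a\<close>, \<open>k\<close> and \<open>t\<close> as their least
    values plus slack turns the next inequality into a coefficientwise comparison of
    polynomials.\<close>
  obtain b where b: "a = 3 + b" using a le_Suc_ex by blast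
  obtain d where d: "k = 2 * a + 1 + d" using k le_Suc_ex by blast
  obtain r where r: "t = 2 + r" using t(2) le_Suc_ex by blast
  have "(k - 1) * s + q + a \<le> a * T + 1"
  proof -
    have "k - a + 1 = 5 + b + d" "k - 1 = 6 + 2 * b + d" unfolding b d by simp_all
    moreover have "q \<le> 3 + b + d" using three_q_bound unfolding b d by simp
    ultimately show ?thesis unfolding T_def t(1) r b by (simp add: algebra_simps)
  qed
  then have "a * x \<le> a * T" using ax by linarith
  then have "x \<le> T" using a by simp
  have "y \<le> T" using y(2) T three_q_bound k by simp
  have "x \<in> B" "y \<in> B" using blue \<open>q \<le> x\<close> \<open>x \<le> T\<close> y \<open>y \<le> T\<close> \<open>T < n\<close> by simp_all
  have "ksum B (k - 1 + 1) ((k - 1) * s + y)"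
    using \<open>s \<in> B\<close> \<open>y \<in> B\<close> by (intro ksum_add ksum_replicate ksum_single)
  then show False using y k B \<open>x \<in> B\<close> solution_freeD by simp
qed

lemma two_in_B: "2 \<in> B"
  using mem_union[of 2] two_notin_R n_ge_7 by simp

text \<open>A red \<open>2 q\<close> solves the equation together with 1 and 3, after cancelling one copy of \<open>2 q\<close> if
  \<open>k\<close> is odd in order to correct the parity.\<close>
lemma not_alternating: "3 \<in> R \<Longrightarrow> 4 \<in> B \<Longrightarrow> False"
proof -
  assume mem: "3 \<in> R" "4 \<in> B"
  \<comment> \<open>Blue 2 and 4 reach every even sum from \<open>2 * k\<close> to
    \<open>4 * k\<close>, and \<open>k \<le> a * q \<le> 2 * k\<close>.\<close>
  have "ksum B k (a * (2 * q))" using two_in_B mem(2) q k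
    by (intro ksum_two[of 2 B 4 "2 * k - a * q" "a * q - k"]) auto
  then have "2 * q \<notin> B" using B solution_freeD by blast
  moreover have "2 * q \<notin> R"
  proof (cases "even k")
    case True
    then obtain h where h: "k = 2 * h" by blast
    have "ksum R k (a * (2 * q))" using RB(2) mem(1) q k unfolding h
      by (intro ksum_two[of 1 R 3 "3 * h - a * q" "a * q - h"]) auto
    then show ?thesis using R solution_freeD by blast
  next
    case False
    then obtain h where h: "k = 2 * h + 1" using oddE by blast
    have aq: "(a - 1) * q = a * q - q" "q \<le> a * q" using a by (simp_all add: diff_mult_distrib)
    have "3 * q \<le> a * q" using a by simp
    then have "h \<le> (a - 1) * q" "(a - 1) * q \<le> 3 * h"
      unfolding aq(1) using q k a q_ge_3 unfolding h by linarith+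
    then have "ksum R (2 * h) ((a - 1) * (2 * q))" using RB(2) mem(1)
      by (intro ksum_two[of 1 R 3 "3 * h - (a - 1) * q" "(a - 1) * q - h"]) auto
    moreover have "k - a + (a - 1) = 2 * h" using a k h by simp
    ultimately show ?thesis using a k
      by (intro solution_free_notin[OF R, of "a - 1"]) simp_all
  qed
  ultimately show False using mem_union[of "2 * q"] two_q_le_n q_ge_3 by simp
qed

lemma not_three_four_in_R: "3 \<in> R \<Longrightarrow> 4 \<in> R \<Longrightarrow> False"
proof -
  assume mem: "3 \<in> R" "4 \<in> R"
  \<comment> \<open>The largest number that red 1, 3, 4 force to be blue. The forced range starts at
    \<open>q + 1\<close> because \<open>a * x \<ge> k + 2\<close> is required, which
    \<open>q\<close> itself may miss.\<close>
  define M where "M = min n (4 * (k - a + 1))"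
  have blue: "x \<in> B" if "q + 1 \<le> x" "x \<le> M" for x
  proof -
    have "a * (q + 1) \<le> a * x" using that(1) by (rule mult_le_mono2)
    then have "x \<notin> R" using RB(2) mem a k q(1) that
      by (intro solution_free_one_three_four[OF R]) (auto simp: M_def)
    then show ?thesis using mem_union[of x] that M_def by simp
  qed
  have M: "2 * q \<le> M" unfolding M_def using two_q_le_n three_q_bound k by simp
  \<comment> \<open>Equivalently \<open>a * M - 2 * k \<ge> q - 1\<close>: the excess over
    \<open>k\<close> twos is enough for one large summand, as \<open>ksum_gap\<close> with
    \<open>h = 1\<close> demands.\<close>
  have aM: "2 * k + q \<le> a * M + 1"
  proof (cases "n \<le> 4 * (k - a + 1)")
    case True
    obtain p where "q = 3 + p" using q_ge_3 le_Suc_ex by blast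
    moreover obtain l where "k = 2 + l" using k a le_Suc_ex[of 2 k] by auto
    ultimately have "2 * k + q \<le> k * q + 1" by (simp add: algebra_simps)
    then show ?thesis using n True by (simp add: M_def)
  next
    case False
    have "3 * (4 * (k - a + 1)) \<le> a * (4 * (k - a + 1))" using a by (rule mult_le_mono1)
    then show ?thesis using False three_q_bound k by (simp add: M_def)
  qed
  define d where "d = a * M - 2 * k"
  have "a * M \<le> k * M" using k by simp
  then have d: "d \<le> k * (M - 2)"
    unfolding d_def diff_mult_distrib2 mult.commute[of k 2] by (rule diff_le_mono)
  have "{2 + (q - 1)..2 + (M - 2)} \<subseteq> B" using M q_ge_3 by (auto intro!: blue)
  then have "ksum B k (k * 2 + d)"
    using two_in_B M aM q_ge_3 k d by (intro ksum_gap[of 2 B "q - 1" "M - 2" 1]) (auto simp: d_def)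
  moreover have "k * 2 + d = a * M" unfolding d_def using aM q_ge_3 by simp
  moreover have "M \<in> B" using M q_ge_3 by (intro blue) auto
  ultimately show False using B solution_freeD by simp
qed

text \<open>Blue 2 and 3 force a red interval starting at \<open>f\<close>, the ceiling of
  \<open>2 * k / a\<close>. Together with the red 1 it represents \<open>a * M\<close> for a
  suitable \<open>M\<close> in that interval.\<close>

lemma three_notin_B: "3 \<notin> B"
proof
  assume mem: "3 \<in> B"
  define f where "f = (2 * k + a - 1) div a"
  have "a * f \<le> 2 * k + a - 1" unfolding f_def by simp
  moreover have "2 * k + a - 1 < a * f + a"
    unfolding f_def using a dividend_less_times_div[of a] by (simp add: add.commute)
  ultimately have f: "2 * k \<le> a * f" "a * f + 1 \<le> 2 * k + a" using a by linarith+
  have red: "x \<in> R" if "f \<le> x" "x \<le> n" "2 * x \<le> 3 * (k - a) + 6" for x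
  proof -
    have ax: "2 * k \<le> a * x" using f(1) that(1) by (meson le_trans mult_le_mono2)
    then have "x \<notin> B" using two_in_B mem a k that
      by (intro solution_free_two_three[OF B]) auto
    moreover have "x \<noteq> 0" using ax k by (intro notI) simp
    ultimately show ?thesis using mem_union[of x] that by simp
  qed
  have "a * 4 < a * f" using f k by linarith
  then have f5: "5 \<le> f" by simp
  have "3 * f \<le> a * f" using a by simp
  then have fk: "f \<le> k" using f k by linarith
  \<comment> \<open>It remains to find \<open>M\<close> in the red range that satisfies the
    conditions of \<open>ksum_gap\<close> for \<open>w = 1\<close> and
    \<open>p = f - 1\<close>.\<close>
  have False if M: "f \<le> M" "M \<le> n" "2 * M \<le> 3 * (k - a) + 6"
    and h: "h \<le> 2" "h \<noteq> 0" "Suc h * (f - 1) \<le> h * (M - 1) + 1" "h * (f - 1) \<le> a * M - k" for M h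
  proof -
    have aM: "2 * k \<le> a * M" using f M(1) by (meson le_trans mult_le_mono2)
    have "a * M \<le> k * M" using k by simp
    then have d: "a * M - k \<le> k * (M - 1)"
      unfolding diff_mult_distrib2 mult_1_right by (rule diff_le_mono)
    have sub: "{1 + (f - 1)..1 + (M - 1)} \<subseteq> R" using M f5 by (auto intro!: red)
    have "h \<le> k" "f - 1 \<le> M - 1" using h(1) k a M(1) by simp_all
    then have "ksum R k (k * 1 + (a * M - k))"
      by (intro ksum_gap[OF RB(2) sub _ h(3,4) _ d])
    then show False using aM R red[of M] M solution_freeD by simp
  qed note contra = this
  show False
  \<comment> \<open>With \<open>h = 1\<close> the gap condition reads
    \<open>M \<ge> 2 * f - 2\<close>, which can exceed \<open>n\<close> if \<open>q = 3\<close>. In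
    that case \<open>f \<le> 6\<close>, and this is just what \<open>h = 2\<close> needs for
    \<open>M = f + 2\<close>.\<close>
  proof (cases "q = 3")
    case True
    have "a * f < a * 7" using f q a unfolding True by linarith
    then have f6: "f = 5 \<or> f = 6" using f5 by simp linarith
    have "f + 2 \<le> n"
    proof (cases "f = 6")
      case True
      then have "5 * a + 1 \<le> 2 * k" using f(2) by simp
      then have "a * 7 < a * n" using n(1) unfolding \<open>q = 3\<close> by linarith
      then show ?thesis using True by simp
    qed (use f6 n_ge_7 in simp)
    moreover have "a * f + a * 2 = a * (f + 2)" by simp
    then have "k + 2 * a \<le> a * (f + 2) - k" using f by linarith
    ultimately show False using f6 k a by (intro contra[of "f + 2" 2]) auto
  next
    case False
    have "a * 4 \<le> a * q" using False q_ge_3 by simp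
    then have k3: "3 * a + 1 \<le> k" using q by linarith
    have "k * 4 \<le> k * q" using False q_ge_3 by simp
    moreover have "a * (2 * f - 2) + 2 * a = 2 * (a * f)" using f5 by (simp add: algebra_simps)
    ultimately have "a * (2 * f - 2) \<le> a * n" using f n by linarith
    then have n': "2 * f - 2 \<le> n" using a by simp
    have "a * 6 < a * f" using f k3 by linarith
    then have f7: "7 \<le> f" by simp
    obtain b where b: "a = 3 + b" using a le_Suc_ex by blast
    have "b * 7 \<le> b * f" using f7 by (rule mult_le_mono2)
    moreover have "a * f = 3 * f + b * f" unfolding b by (rule add_mult_distrib)
    ultimately have "3 * f + 7 * b + 1 \<le> 2 * k + a" using f(2) by linarith
    then have M: "2 * (2 * f - 2) \<le> 3 * (k - a) + 6" using k3 b by linarith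
    have "a * f \<le> a * (2 * f - 2)" using f5 by (intro mult_le_mono2) simp
    then have "f \<le> a * (2 * f - 2) - k" using f fk by linarith
    then show False using n' M f5 by (intro contra[of "2 * f - 2" 1]) auto
  qed
qed

lemma contradiction: False
  using mem_union[of 3] mem_union[of 4] n_ge_7 not_alternating not_three_four_in_R three_notin_B by auto

end

section \<open>Lower bound and the value for \<open>k \<ge> 2 * a + 1\<close>\<close>

text \<open>Below \<open>q\<close> the right side is at most \<open>a * (q - 1) < k\<close>, too
  small for \<open>k\<close> positive summands. From \<open>q\<close> on the sum is at least
  \<open>k * q\<close>, while the right side is at most \<open>a * (n - 1) < k * q\<close>.\<close>

lemma solution_free_class:
  assumes "k \<le> a * q" "a * q < k + a" "a * n < k * q + a" "0 < a"
  shows "solution_free a k {z \<in> {1..n - 1}. z < q}" "solution_free a k {z \<in> {1..n - 1}. \<not> z < q}"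
proof -
  have "\<not> ksum {z \<in> {1..n - 1}. z < q} k (a * x)" if "x < q" for x
  proof
    assume "ksum {z \<in> {1..n - 1}. z < q} k (a * x)"
    then have "k * 1 \<le> a * x" by (rule ksum_ge) auto
    moreover have "a * (x + 1) \<le> a * q" using that by (intro mult_le_mono2) simp
    ultimately show False using assms by simp
  qed
  then show "solution_free a k {z \<in> {1..n - 1}. z < q}" unfolding solution_free_def by blast
  have "\<not> ksum {z \<in> {1..n - 1}. \<not> z < q} k (a * x)" if "1 \<le> x" "x \<le> n - 1" for x
  proof
    assume "ksum {z \<in> {1..n - 1}. \<not> z < q} k (a * x)"
    then have "k * q \<le> a * x" by (rule ksum_ge) auto
    moreover have "a * (x + 1) \<le> a * n" using that by (intro mult_le_mono2) simp
    ultimately show False using assms by simp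
  qed
  then show "solution_free a k {z \<in> {1..n - 1}. \<not> z < q}" unfolding solution_free_def by simp
qed

lemma rado2_eq_C_bound:
  assumes "3 \<le> a" "2 * a + 1 \<le> k"
  shows "rado2 (Suc k) a = enat (C_bound (Suc k) a)"
proof -
  define n where "n = C_bound (Suc k) a"
  obtain q where q: "k \<le> a * q" "a * q < k + a" "k * q \<le> a * n" "a * n < k * q + a"
    using C_bound_bounds[of a k] assms(1) unfolding n_def by auto
  have "n \<noteq> 0"
  proof
    assume "n = 0"
    then have "k = 0 \<or> q = 0" using q(3) by simp
    then show False using q(1) assms by auto
  qed
  show ?thesis unfolding n_def[symmetric]
  proof (rule rado2_eqI)
    show "1 \<le> n" using \<open>n \<noteq> 0\<close> by simp
    show "solution_free a k {z \<in> {1..n - 1}. z < q}" "solution_free a k {z \<in> {1..n - 1}. \<not> z < q}"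
      using solution_free_class[OF q(1,2,4)] assms(1) by simp_all
  next
    fix R B
    assume "R \<union> B = {1..n}" "1 \<in> R" "solution_free a k R" "solution_free a k B"
    then interpret long_rado_coloring a k q n R B
      using assms q by unfold_locales
    show False by (rule contradiction)
  qed
qed

section \<open>The short cases \<open>k = 2 * a - 1\<close> and \<open>k = 2 * a\<close>\<close>

text \<open>Since \<open>2 * a - k\<close> is 0 or 1, the sum \<open>2 * a\<close> consists of ones
  and at most one 2. Doubling everything gives the solution in 2 and 4.\<close>

lemma short_two_four:
  assumes "3 \<le> a" "k \<le> 2 * a" "2 * a \<le> k + 1" "4 \<le> n"
    and RB: "R \<union> B = {1..n}" "1 \<in> R" and R: "solution_free a k R" and B: "solution_free a k B"
  shows "2 \<in> B" "4 \<in> R"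
proof -
  have mem: "x \<in> R \<or> x \<in> B" if "1 \<le> x" "x \<le> 4" for x
    using that assms(4) RB(1) by (metis UnE atLeastAtMost_iff le_trans)
  have "2 \<notin> R"
  proof
    assume "2 \<in> R"
    then have "ksum R k (a * 2)" using RB(2) assms(1-3)
      by (intro ksum_two[of 1 R 2 "k - (2 * a - k)" "2 * a - k"]) auto
    then show False using \<open>2 \<in> R\<close> R solution_freeD by blast
  qed
  then show "2 \<in> B" using mem[of 2] by simp
  have "4 \<notin> B"
  proof
    assume "4 \<in> B"
    then have "ksum B k (a * 4)" using \<open>2 \<in> B\<close> assms(1-3)
      by (intro ksum_two[of 2 B 4 "k - (2 * a - k)" "2 * a - k"]) auto
    then show False using \<open>4 \<in> B\<close> B solution_freeD by blast
  qed
  then show "4 \<in> R" using mem[of 4] by simp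
qed

text \<open>The classes \<open>{1, 4}\<close> and \<open>{2, 3}\<close> avoid solutions, the sum
  \<open>4 * a\<close> being excluded modulo 3. Conversely 1, 4 red and 2 blue force 3 to be blue,
  then 5 to be red, and then 1, 4, 5 yield \<open>4 * a\<close>.\<close>

lemma rado2_eq_5:
  assumes a: "3 \<le> a" and k: "k \<le> 2 * a" "2 * a \<le> k + 1" and mod3: "(4 * a) mod 3 \<noteq> k mod 3"
  shows "rado2 (Suc k) a = 5"
proof -
  have "rado2 (Suc k) a = enat 5"
  proof (rule rado2_eqI[where c = "\<lambda>z. z = 1 \<or> z = 4"])
    have R4: "{z \<in> {1..5 - 1}. z = 1 \<or> z = 4} = {1, 4::nat}"
      and B4: "{z \<in> {1..5 - 1}. \<not> (z = 1 \<or> z = 4)} = {2, 3::nat}" by auto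
    have "x mod 3 = 1 mod 3" if "x \<in> {1, 4}" for x :: nat using that by auto
    then have "\<not> ksum {1, 4} k (a * 4)"
      using ksum_cong_mod[of "{1, 4}" k "a * 4" 3 1] mod3 by (metis mult.commute mult_1_right)
    moreover have "\<not> ksum {1, 4} k (a * 1)" using ksum_ge[of "{1, 4}" k "a * 1" 1] a k by fastforce
    ultimately show "solution_free a k {z \<in> {1..5 - 1}. z = 1 \<or> z = 4}"
      unfolding R4 solution_free_def by simp
    have "\<not> ksum {2, 3} k (a * x)" if "x \<le> 3" for x
    proof
      assume "ksum {2, 3} k (a * x)"
      then have "k * 2 \<le> a * x" by (rule ksum_ge) auto
      moreover have "a * x \<le> a * 3" using that by simp
      ultimately show False using a k by linarith
    qed
    then show "solution_free a k {z \<in> {1..5 - 1}. \<not> (z = 1 \<or> z = 4)}"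
      unfolding B4 solution_free_def by simp
  next
    fix R B
    assume RB: "R \<union> B = {1..5::nat}" "1 \<in> R" and R: "solution_free a k R" and B: "solution_free a k B"
    note mem = short_two_four[OF a k _ RB R B, simplified]
    have "3 \<notin> R"
    proof
      assume "3 \<in> R"
      then have "ksum R k (a * 3)" using RB(2) mem a k by (intro ksum_one_three_four) auto
      then show False using R \<open>3 \<in> R\<close> solution_freeD by blast
    qed
    have "3 \<in> R \<union> B" "5 \<in> R \<union> B" unfolding RB(1) by simp_all
    then have "3 \<in> B" using \<open>3 \<notin> R\<close> by simp
    have "{2..3} = {2, 3::nat}" by auto
    \<comment> \<open>The upper bound \<open>5 * a \<le> 3 * k\<close> follows from
      \<open>3 * k \<ge> 6 * a - 3\<close> and \<open>a \<ge> 3\<close>.\<close>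
    then have "ksum B k (a * 5)" using mem \<open>3 \<in> B\<close> a k by (intro ksum_interval[of 2 3]) auto
    then have "5 \<in> R" using B \<open>5 \<in> R \<union> B\<close> solution_freeD by blast
    have "{1 + 3..1 + 4} = {4, 5::nat}" by auto
    \<comment> \<open>Two large summands suffice to close the gaps, with equality:
      \<open>3 * 3 = 2 * 4 + 1\<close>.\<close>
    then have "ksum R k (k * 1 + (4 * a - k))" using RB(2) mem \<open>5 \<in> R\<close> a k
      by (intro ksum_gap[of 1 R 3 4 2]) auto
    then show False using R mem k a solution_freeD[of a k R 4] by (simp add: mult.commute)
  qed simp
  then show ?thesis by (simp add: numeral_eq_enat)
qed

text \<open>If \<open>a = 3 * b\<close>, then \<open>4 * b\<close> ones and \<open>2 * b\<close>
  fours add up to \<open>4 * a\<close>, so 1 and 4 cannot share a colour.\<close>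

lemma rado2_eq_4:
  assumes "3 \<le> a" "3 dvd a"
  shows "rado2 (Suc (2 * a)) a = enat 4"
proof -
  define n :: nat where "n = 4"
  show ?thesis unfolding n_def[symmetric]
  proof (rule rado2_eqI)
    show "1 \<le> n" by (simp add: n_def)
    show "solution_free a (2 * a) {z \<in> {1..n - 1}. z < 2}"
      "solution_free a (2 * a) {z \<in> {1..n - 1}. \<not> z < 2}"
      using assms(1) solution_free_class[of "2 * a" a 2 n] by (simp_all add: n_def)
  next
    fix R B
    assume RB: "R \<union> B = {1..n}" "1 \<in> R"
      and R: "solution_free a (2 * a) R" and B: "solution_free a (2 * a) B"
    have "4 \<in> R" using short_two_four(2)[OF assms(1) _ _ _ RB R B] by (simp add: n_def)
    obtain b where "a = 3 * b" using assms(2) by blast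
    then have "ksum R (2 * a) (a * 4)" using RB(2) \<open>4 \<in> R\<close>
      by (intro ksum_two[of 1 R 4 "4 * b" "2 * b"]) auto
    then show False using R \<open>4 \<in> R\<close> solution_freeD by blast
  qed
qed

theorem theorem3:
  fixes a :: nat
  assumes "a \<ge> 3"
  shows "(3 dvd a \<longrightarrow>
            (\<forall>m \<ge> 2 * a + 1. rado2 m a = enat (C_bound m a)) \<and>
            rado2 (2 * a) a = 5 \<and> C_bound (2 * a) a = 4) \<and>
         (\<not> 3 dvd a \<longrightarrow>
            (\<forall>m \<ge> 2 * a + 2. rado2 m a = enat (C_bound m a)) \<and>
            rado2 (2 * a + 1) a = 5 \<and> C_bound (2 * a + 1) a = 4)"
proof -
  have long: "rado2 m a = enat (C_bound m a)" if "2 * a + 2 \<le> m" for m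
    using rado2_eq_C_bound[OF assms, of "m - 1"] that by simp
  have C: "C_bound (2 * a) a = 4" "C_bound (2 * a + 1) a = 4"
    using C_bound_eq_4[OF assms, of "2 * a - 1"] C_bound_eq_4[OF assms, of "2 * a"] assms by simp_all
  show ?thesis
  proof (cases "3 dvd a")
    case True
    then obtain b where b: "a = 3 * b" by blast
    then obtain c where c: "b = Suc c" using assms by (cases b) auto
    have "2 * a - 1 = 2 + 3 * (2 * c + 1)" unfolding b c by simp
    then have "(2 * a - 1) mod 3 = 2" by (simp only: mod_mult_self2) simp
    moreover have "(4 * a) mod 3 = 0" unfolding b by simp
    ultimately have "rado2 (2 * a) a = 5" using rado2_eq_5[OF assms, of "2 * a - 1"] assms by simp
    moreover have "rado2 m a = enat (C_bound m a)" if "2 * a + 1 \<le> m" for m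
    \<comment> \<open>The one value of \<open>m\<close> not covered by \<open>long\<close>; there
      both sides are 4.\<close>
    proof (cases "m = Suc (2 * a)")
      case True
      then show ?thesis using rado2_eq_4[OF assms \<open>3 dvd a\<close>] C by simp
    next
      case False
      then show ?thesis using that by (intro long) simp
    qed
    ultimately show ?thesis using True C by blast
  next
    case False
    \<comment> \<open>The difference \<open>2 * a\<close> is not divisible by 3.\<close>
    then have "(4 * a) mod 3 \<noteq> (2 * a) mod 3" by presburger
    then have "rado2 (2 * a + 1) a = 5" using rado2_eq_5[OF assms, of "2 * a"] by simp
    then show ?thesis using False C long by blast
  qed
qed

end
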